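(* Let $\alpha,\beta>-1$, $0<k<\beta+1$, $\ell\in\mathbb N$. Assume that all the eigenvalues $\lambda_j(w)$, $w\in\mathbb N_0$, $0\le j\le\ell$, are different (i.e. $\lambda_j(w)=\lambda_{j'}(w')$ only if $(w,j)=(w',j')$). If $\lambda=\lambda_j(w)$ for some $w\in\mathbb N_0$ and some $j=0,\dots,\ell$, then there exists a unique (up to scalars) nonzero $F_0\in\mathbb C^{\ell+1}$ such that $$F(u)={}_2H_1\left(\begin{smallmatrix}U\,;\,V+\lambda\\ C\end{smallmatrix};u\right)F_0$$ is a polynomial function. Moreover this polynomial is of degree $w$.
   Context: Matrices are $(\ell+1)\times(\ell+1)$ with rows and columns indexed by $0,\dots,\ell$; $E_{ij}$ is the matrix with $(i,j)$ entry $1$ and all other entries $0$. $\mathbb N=\{1,2,\dots\}$, $\mathbb N_0=\mathbb N\cup\{0\}$. For $w\in\mathbb N_0$ and $0\le j\le\ell$, $$\lambda_j(w)=-w(w+\alpha+\beta+\ell+j+1)-j(\alpha+\beta-k+1+j).$$ Let $$C=\sum_{i=0}^\ell(\beta+1+2i)E_{ii}+\sum_{i=1}^\ell iE_{i,i-1},\qquad U=\sum_{i=0}^\ell(\alpha+\beta+\ell+i+2)E_{ii},$$ $$V=\sum_{i=0}^\ell i(\alpha+\beta+i-k+1)E_{ii}-\sum_{i=0}^{\ell-1}(\ell-i)(i+\beta-k+1)E_{i,i+1}.$$ For $|u|<1$, $${}_2H_1\left(\begin{smallmatrix}U\,;\,V+\lambda\\ C\end{smallmatrix};u\right)=\sum_{i=0}^\infty\frac{u^i}{i!}[C;U;V+\lambda]_i,$$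 where $[C;U;V+\lambda]_0=I$ and $[C;U;V+\lambda]_{i+1}=(C+i)^{-1}\big(i(U+i-1)+V+\lambda\big)[C;U;V+\lambda]_i$ for $i\ge0$ (scalars denote multiples of the identity matrix). *)

theory Defs
  imports
    Complex_Main
    "HOL-Computational_Algebra.Polynomial"
    "Jordan_Normal_Form.Gauss_Jordan_Elimination"
begin

definition jacobi_eigenvalue :: "real \<Rightarrow> real \<Rightarrow> real \<Rightarrow> nat \<Rightarrow> nat \<Rightarrow> nat \<Rightarrow> real" where
  "jacobi_eigenvalue \<alpha> \<beta> k l j w =
     - real w * (real w + \<alpha> + \<beta> + real l + real j + 1) - real j * (\<alpha> + \<beta> - k + 1 + real j)"

definition C_mat :: "real \<Rightarrow> nat \<Rightarrow> complex mat" where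
  "C_mat \<beta> l = mat (l + 1) (l + 1) (\<lambda>(r, c).
     if c = r then of_real (\<beta> + 1 + 2 * real r)
     else if c + 1 = r then of_nat r
     else 0)"

definition U_mat :: "real \<Rightarrow> real \<Rightarrow> nat \<Rightarrow> complex mat" where
  "U_mat \<alpha> \<beta> l = mat (l + 1) (l + 1) (\<lambda>(r, c).
     if c = r then of_real (\<alpha> + \<beta> + real l + real r + 2)
     else 0)"

definition V_mat :: "real \<Rightarrow> real \<Rightarrow> real \<Rightarrow> nat \<Rightarrow> complex mat" where
  "V_mat \<alpha> \<beta> k l = mat (l + 1) (l + 1) (\<lambda>(r, c).
     if c = r then of_real (real r * (\<alpha> + \<beta> + real r - k + 1))
     else if c = r + 1 then of_real (- (real l - real r) * (real r + \<beta> - k + 1))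
     else 0)"

text \<open>The coefficient \<open>[C; U; W]\<^sub>i\<close> of the matrix-valued hypergeometric series, for
  \<open>n \<times> n\<close> matrices. It is only meaningful if every \<open>C + i\<close> is invertible; otherwise
  \<^const>\<open>mat_inverse\<close> returns \<^const>\<open>None\<close> and the value is unspecified.\<close>

primrec hyp_coeff ::
  "nat \<Rightarrow> complex mat \<Rightarrow> complex mat \<Rightarrow> complex mat \<Rightarrow> nat \<Rightarrow> complex mat" where
  "hyp_coeff n C U W 0 = 1\<^sub>m n"
| "hyp_coeff n C U W (Suc i) =
     the (mat_inverse (C + of_nat i \<cdot>\<^sub>m 1\<^sub>m n))
     * (of_nat i \<cdot>\<^sub>m (U + (of_nat i - 1) \<cdot>\<^sub>m 1\<^sub>m n) + W)
     * hyp_coeff n C U W i"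

text \<open>The type of matrices of all dimensions carries no topology, so the series is summed
  entrywise.\<close>

definition matrix_2H1 ::
  "nat \<Rightarrow> complex mat \<Rightarrow> complex mat \<Rightarrow> complex mat \<Rightarrow> complex \<Rightarrow> complex mat" where
  "matrix_2H1 n U W C u = mat n n (\<lambda>(r, c). \<Sum>i. u ^ i / fact i * hyp_coeff n C U W i $$ (r, c))"

text \<open>Functions given by the series are only considered on the unit disc, hence a vector-valued
  function is a polynomial function if it agrees there with a vector of polynomials.\<close>

definition represents_on_disc ::
  "nat \<Rightarrow> (complex \<Rightarrow> complex vec) \<Rightarrow> complex poly vec \<Rightarrow> bool" where
  "represents_on_disc n F P \<longleftrightarrow>
     P \<in> carrier_vec n \<and> (\<forall>u. norm u < 1 \<longrightarrow> F u = map_vec (\<lambda>p. poly p u) P)"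

definition vec_polynomial :: "nat \<Rightarrow> (complex \<Rightarrow> complex vec) \<Rightarrow> bool" where
  "vec_polynomial n F \<longleftrightarrow> (\<exists>P. represents_on_disc n F P)"

text \<open>The zero polynomial is given no degree; otherwise the degree is the largest power of \<open>u\<close>
  with a nonzero vector coefficient.\<close>

definition vec_polynomial_of_degree :: "nat \<Rightarrow> (complex \<Rightarrow> complex vec) \<Rightarrow> nat \<Rightarrow> bool" where
  "vec_polynomial_of_degree n F d \<longleftrightarrow>
     (\<exists>P. represents_on_disc n F P \<and> P \<noteq> 0\<^sub>v n \<and> d = (MAX i\<in>{..<n}. degree (P $ i)))"

definition F_fun ::
  "real \<Rightarrow> real \<Rightarrow> real \<Rightarrow> nat \<Rightarrow> complex \<Rightarrow> complex vec \<Rightarrow> complex \<Rightarrow> complex vec" where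
  "F_fun \<alpha> \<beta> k l lam F0 u =
     matrix_2H1 (l + 1) (U_mat \<alpha> \<beta> l) (V_mat \<alpha> \<beta> k l + lam \<cdot>\<^sub>m 1\<^sub>m (l + 1)) (C_mat \<beta> l) u *\<^sub>v F0"

end

theory Submission
  imports
    Defs
    "Jordan_Normal_Form.Determinant"
    "HOL-Real_Asymp.Real_Asymp"
begin

text \<open>Applied to a vector \<open>v\<close>, the series has the coefficients \<open>x\<^sub>i / i!\<close> with \<open>x\<^sub>0 = v\<close> and
  \<open>(C + i) x\<^bsub>i+1\<^esub> = M\<^sub>i x\<^sub>i\<close>, where \<open>M\<^sub>i = i (U + i - 1) + V + \<lambda>\<close>. The matrix \<open>C + i\<close> is lower triangular
  with positive diagonal, hence invertible. The matrix \<open>M\<^sub>i\<close> is upper triangular, and its diagonal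
  entry in row \<open>r\<close> is exactly \<open>\<lambda> - \<lambda>\<^sub>r(i)\<close> (\<open>hyp_step_jacobi\<close>). Because the eigenvalues are distinct,
  the choice \<open>\<lambda> = \<lambda>\<^sub>j(w)\<close> makes every \<open>M\<^sub>i\<close> with \<open>i \<noteq> w\<close> invertible, while \<open>M\<^sub>w\<close> has a single zero
  on its diagonal, in row \<open>j\<close>, and therefore a one-dimensional kernel
  (\<open>upper_triangular_kernel_1_dim\<close>).

  So for \<open>v \<noteq> 0\<close> the vectors \<open>x\<^sub>0, \<dots>, x\<^sub>w\<close> do not vanish, and beyond \<open>w\<close> they vanish all together or
  not at all. The series terminates if and only if \<open>x\<^sub>w\<close> lies in the kernel of \<open>M\<^sub>w\<close>; as \<open>x\<^sub>w\<close>
  depends on \<open>v\<close> through an invertible matrix, this singles out one line of vectors \<open>v\<close>, and the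
  top coefficient then sits at \<open>w\<close>.

  To pass between functions on the disc and coefficient sequences, the series must converge
  there: \<open>M\<^sub>i\<close> grows like \<open>i\<^sup>2\<close> and \<open>C + i\<close> like \<open>i\<close>, so the terms \<open>x\<^sub>i / i!\<close> grow at most by a factor that
  tends to \<open>1\<close> (\<open>summable_coeff_vec\<close>). Uniqueness of power series coefficients then shows that the
  sum is a polynomial only if the series terminates (\<open>vec_polynomial_matrix_2H1_iff\<close>).\<close>

section \<open>Uniqueness of power series coefficients\<close>

text \<open>Once the coefficients below \<open>m\<close> are known to vanish, dividing by \<open>u ^ m\<close> off the origin and
  letting \<open>u\<close> tend to \<open>0\<close> isolates the coefficient \<open>a m\<close>.\<close>

lemma powser_zero_on_disc_imp_coeff_zero:
  fixes a :: "nat \<Rightarrow> 'a::{real_normed_field,banach}"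
  assumes "0 < s" and sums0: "\<And>u. norm u < s \<Longrightarrow> (\<lambda>i. a i * u ^ i) sums 0"
  shows "a m = 0"
proof (induction m rule: less_induct)
  case (less m)
  have "(\<lambda>i. a (i + m) * u ^ i) sums 0" if "u \<noteq> 0" "norm u < s" for u
  proof -
    have "(\<lambda>i. a (i + m) * u ^ (i + m)) sums (0 - (\<Sum>i<m. a i * u ^ i))"
      using sums0[OF that(2)] by (subst sums_iff_shift) simp
    hence "(\<lambda>i. a (i + m) * u ^ (i + m)) sums 0"
      using less by simp
    hence "(\<lambda>i. inverse (u ^ m) * (a (i + m) * u ^ (i + m))) sums (inverse (u ^ m) * 0)"
      by (rule sums_mult)
    thus ?thesis
      using that(1) by (simp add: power_add field_simps)
  qed
  from powser_limit_0_strong[of s "\<lambda>i. a (i + m)", OF \<open>0 < s\<close> this]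
  have "((\<lambda>_. 0) \<longlongrightarrow> a (0 + m)) (at (0::'a))" by blast
  thus ?case by (simp add: tendsto_const_iff)
qed

lemma poly_eq_powser_imp_coeff_eq:
  fixes p :: "'a::{real_normed_field,banach} poly"
  assumes sums_poly: "\<And>u. norm u < 1 \<Longrightarrow> (\<lambda>i. a i * u ^ i) sums poly p u"
  shows "a i = coeff p i"
proof -
  have "(\<lambda>i. (a i - coeff p i) * u ^ i) sums 0" if "norm u < 1" for u
  proof -
    have "(\<lambda>i. coeff p i * u ^ i) sums (\<Sum>i\<le>degree p. coeff p i * u ^ i)"
      by (rule sums_finite) (auto simp: coeff_eq_0)
    with sums_poly[OF that] show ?thesis
      by (auto dest: sums_diff simp: poly_altdef algebra_simps)
  qed
  from powser_zero_on_disc_imp_coeff_zero[of 1, OF _ this] show ?thesis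
    by simp
qed

section \<open>The 1-norm of a vector\<close>

definition vec_l1 :: "complex vec \<Rightarrow> real" where
  "vec_l1 v = (\<Sum>r<dim_vec v. norm (v $ r))"

lemma vec_l1_nonneg [simp]: "vec_l1 v \<ge> 0"
  by (simp add: vec_l1_def sum_nonneg)

lemma norm_component_le_vec_l1: "r < dim_vec v \<Longrightarrow> norm (v $ r) \<le> vec_l1 v"
  unfolding vec_l1_def by (rule member_le_sum) auto

lemma vec_l1_smult [simp]: "vec_l1 (c \<cdot>\<^sub>v v) = norm c * vec_l1 v"
  by (simp add: vec_l1_def norm_mult sum_distrib_left)

lemma vec_l1_add:
  "v \<in> carrier_vec n \<Longrightarrow> w \<in> carrier_vec n \<Longrightarrow> vec_l1 (v + w) \<le> vec_l1 v + vec_l1 w"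
  by (auto simp: vec_l1_def sum.distrib[symmetric] intro!: sum_mono norm_triangle_ineq)

lemma mult_mat_vec_bounded:
  fixes A :: "complex mat"
  assumes A: "A \<in> carrier_mat n n"
  obtains c where "\<And>v. v \<in> carrier_vec n \<Longrightarrow> vec_l1 (A *\<^sub>v v) \<le> c * vec_l1 v"
proof
  let ?c = "\<Sum>r<n. \<Sum>s<n. norm (A $$ (r, s))"
  fix v :: "complex vec" assume v: "v \<in> carrier_vec n"
  have "vec_l1 (A *\<^sub>v v) = (\<Sum>r<n. norm (\<Sum>s<n. A $$ (r, s) * v $ s))"
    using A v by (simp add: vec_l1_def scalar_prod_def lessThan_atLeast0)
  also have "\<dots> \<le> (\<Sum>r<n. \<Sum>s<n. norm (A $$ (r, s)) * vec_l1 v)"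
    using v by (intro sum_mono order.trans[OF norm_sum])
      (auto simp: norm_mult intro!: mult_left_mono norm_component_le_vec_l1)
  also have "\<dots> = ?c * vec_l1 v"
    by (simp add: sum_distrib_right)
  finally show "vec_l1 (A *\<^sub>v v) \<le> ?c * vec_l1 v" .
qed

section \<open>Linear algebra of triangular matrices\<close>

lemma smult_mat_mult_vec:
  fixes A :: "'a::comm_ring_1 mat"
  assumes "A \<in> carrier_mat m n" "v \<in> carrier_vec n"
  shows "(c \<cdot>\<^sub>m A) *\<^sub>v v = c \<cdot>\<^sub>v (A *\<^sub>v v)"
  using assms by (intro eq_vecI) (auto simp: scalar_prod_def sum_distrib_left mult.assoc)

lemma mult_mat_zero_vec:
  "A \<in> carrier_mat m n \<Longrightarrow> A *\<^sub>v 0\<^sub>v n = (0\<^sub>v m :: 'a::comm_ring_1 vec)"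
  by (intro eq_vecI) auto

lemma vec_diff_eq_zero_imp_eq:
  fixes x y :: "'a::ab_group_add vec"
  assumes "x \<in> carrier_vec n" "y \<in> carrier_vec n" and zero: "x - y = 0\<^sub>v n"
  shows "x = y"
proof (rule eq_vecI)
  fix r assume "r < dim_vec y"
  with arg_cong[OF zero, of "\<lambda>v. v $ r"] assms(1,2) show "x $ r = y $ r" by simp
qed (use assms in auto)

text \<open>In the row of the last nonzero component of \<open>x\<close>, only the diagonal entry of the matrix
  contributes: the entries to its left vanish by triangularity, those to its right meet zeros
  of \<open>x\<close>.\<close>

lemma upper_triangular_mult_vec_component:
  fixes A :: "'a::comm_ring_1 mat"
  assumes A: "A \<in> carrier_mat n n" "upper_triangular A" and x: "x \<in> carrier_vec n"
    and r: "r < n" and zero: "\<And>s. r < s \<Longrightarrow> s < n \<Longrightarrow> x $ s = 0"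
  shows "(A *\<^sub>v x) $ r = A $$ (r, r) * x $ r"
proof -
  have "(A *\<^sub>v x) $ r = (\<Sum>s\<in>{0..<n}. A $$ (r, s) * x $ s)"
    using A x r by (simp add: scalar_prod_def)
  also have "\<dots> = (\<Sum>s\<in>{0..<n}. if s = r then A $$ (r, r) * x $ r else 0)"
  proof (intro sum.cong refl)
    fix s assume s: "s \<in> {0..<n}"
    consider "s < r" | "s = r" | "s > r" by linarith
    thus "A $$ (r, s) * x $ s = (if s = r then A $$ (r, r) * x $ r else 0)"
    proof cases
      case 1
      thus ?thesis using A r upper_triangularD[OF A(2), of s r] by simp
    qed (use s zero in auto)
  qed
  finally show ?thesis using r by simp
qed

text \<open>The last nonzero component of a nonzero kernel vector must face a zero on the diagonal. Hence
  with at most one such zero, in row \<open>j\<close>, the linear form \<open>x \<mapsto> x $ j\<close> is injective on the kernel,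
  which bounds its dimension by one.\<close>

lemma upper_triangular_kernel_component_zero:
  fixes A :: "'a::field mat"
  assumes A: "A \<in> carrier_mat n n" "upper_triangular A"
    and diag: "\<And>r. r < n \<Longrightarrow> r \<noteq> j \<Longrightarrow> A $$ (r, r) \<noteq> 0"
    and x: "x \<in> carrier_vec n" "A *\<^sub>v x = 0\<^sub>v n" "x $ j = 0"
  shows "x = 0\<^sub>v n"
proof (rule ccontr)
  assume "x \<noteq> 0\<^sub>v n"
  then obtain s where s: "s < n" "x $ s \<noteq> 0"
    using x(1) by (metis carrier_vecD eq_vecI index_zero_vec)
  define r where "r = Max {s. s < n \<and> x $ s \<noteq> 0}"
  have fin: "finite {s. s < n \<and> x $ s \<noteq> 0}" by simp
  have r: "r < n" "x $ r \<noteq> 0"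
    using Max_in[OF fin] s unfolding r_def by blast+
  have "x $ s = 0" if "r < s" "s < n" for s
    using Max_ge[OF fin, of s] that unfolding r_def by fastforce
  from upper_triangular_mult_vec_component[OF A x(1) r(1) this]
  have "A $$ (r, r) * x $ r = 0"
    using x(2) r(1) by simp
  thus False using diag[of r] r x(3) by auto
qed

lemma upper_triangular_kernel_1_dim:
  fixes A :: "'a::field mat"
  assumes A: "A \<in> carrier_mat n n" "upper_triangular A"
    and diag: "\<And>r. r < n \<Longrightarrow> r \<noteq> j \<Longrightarrow> A $$ (r, r) \<noteq> 0"
    and j: "j < n"
    and x: "x \<in> carrier_vec n" "A *\<^sub>v x = 0\<^sub>v n" "x \<noteq> 0\<^sub>v n"
    and y: "y \<in> carrier_vec n" "A *\<^sub>v y = 0\<^sub>v n"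
  shows "\<exists>c. y = c \<cdot>\<^sub>v x"
proof -
  have xj: "x $ j \<noteq> 0"
    using upper_triangular_kernel_component_zero[OF A diag x(1,2)] x(3) by blast
  define c where "c = y $ j / x $ j"
  have "A *\<^sub>v (y - c \<cdot>\<^sub>v x) = A *\<^sub>v y - c \<cdot>\<^sub>v (A *\<^sub>v x)"
    using A(1) x(1) y(1) by (simp add: mult_minus_distrib_mat_vec mult_mat_vec)
  also have "\<dots> = 0\<^sub>v n"
    unfolding x(2) y(2) by (intro eq_vecI) auto
  finally have "A *\<^sub>v (y - c \<cdot>\<^sub>v x) = 0\<^sub>v n" .
  moreover have "(y - c \<cdot>\<^sub>v x) $ j = 0"
    using x y j xj by (simp add: c_def)
  moreover have "y - c \<cdot>\<^sub>v x \<in> carrier_vec n"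
    using x y by simp
  ultimately have "y - c \<cdot>\<^sub>v x = 0\<^sub>v n"
    using upper_triangular_kernel_component_zero[OF A diag] by blast
  hence "y = c \<cdot>\<^sub>v x"
    using x y by (auto intro: vec_diff_eq_zero_imp_eq[of _ n])
  thus ?thesis ..
qed

lemma det_nonzero_imp_mult_vec_eq_zero:
  fixes A :: "'a::field mat"
  assumes "A \<in> carrier_mat n n" "det A \<noteq> 0" "v \<in> carrier_vec n" "A *\<^sub>v v = 0\<^sub>v n"
  shows "v = 0\<^sub>v n"
  using assms det_0_iff_vec_prod_zero_field by blast

section \<open>The matrix hypergeometric series\<close>

definition hyp_step :: "nat \<Rightarrow> complex mat \<Rightarrow> complex mat \<Rightarrow> nat \<Rightarrow> complex mat" where
  "hyp_step n U W i = of_nat i \<cdot>\<^sub>m (U + (of_nat i - 1) \<cdot>\<^sub>m 1\<^sub>m n) + W"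

locale matrix_hypergeometric =
  fixes n :: nat and C U W :: "complex mat"
  assumes C_carrier: "C \<in> carrier_mat n n"
    and U_carrier: "U \<in> carrier_mat n n"
    and W_carrier: "W \<in> carrier_mat n n"
    and det_C_shift: "det (C + of_nat i \<cdot>\<^sub>m 1\<^sub>m n) \<noteq> 0"
begin

lemma hyp_step_carrier [simp]: "hyp_step n U W i \<in> carrier_mat n n"
  using U_carrier W_carrier by (auto simp: hyp_step_def)

lemma C_shift_carrier [simp]: "C + of_nat i \<cdot>\<^sub>m 1\<^sub>m n \<in> carrier_mat n n"
  using C_carrier by auto

lemma C_shift_mat_inverse:
  obtains B where "mat_inverse (C + of_nat i \<cdot>\<^sub>m 1\<^sub>m n) = Some B" "B \<in> carrier_mat n n"
    "(C + of_nat i \<cdot>\<^sub>m 1\<^sub>m n) * B = 1\<^sub>m n"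
proof -
  have "mat_inverse (C + of_nat i \<cdot>\<^sub>m 1\<^sub>m n) \<noteq> None"
    using det_non_zero_imp_unit[OF C_shift_carrier det_C_shift, of i "()"]
      mat_inverse(1)[OF C_shift_carrier, of i "()"] by argo
  then obtain B where "mat_inverse (C + of_nat i \<cdot>\<^sub>m 1\<^sub>m n) = Some B"
    by blast
  with mat_inverse(2)[OF C_shift_carrier this] that show ?thesis by blast
qed

lemma hyp_coeff_carrier [simp]: "hyp_coeff n C U W i \<in> carrier_mat n n"
proof (induction i)
  case (Suc i)
  obtain B where B: "mat_inverse (C + of_nat i \<cdot>\<^sub>m 1\<^sub>m n) = Some B" "B \<in> carrier_mat n n"
    by (rule C_shift_mat_inverse)
  from hyp_step_carrier[of i] Suc B show ?case by (simp add: hyp_step_def)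
qed simp

lemma dim_hyp_coeff [simp]:
  "dim_row (hyp_coeff n C U W i) = n" "dim_col (hyp_coeff n C U W i) = n"
  using hyp_coeff_carrier[of i] by (simp_all only: carrier_mat_def mem_Collect_eq)

abbreviation coeff_vec :: "complex vec \<Rightarrow> nat \<Rightarrow> complex vec" where
  "coeff_vec v i \<equiv> hyp_coeff n C U W i *\<^sub>v v"

lemma coeff_vec_carrier [simp]: "v \<in> carrier_vec n \<Longrightarrow> coeff_vec v i \<in> carrier_vec n"
  by (rule mult_mat_vec_carrier[OF hyp_coeff_carrier])

text \<open>Multiplying by \<open>C + i\<close> removes the inverse from the recursion; in this implicit form
  the invertibility of \<open>C + i\<close> and the growth of both sides can be exploited separately.\<close>

lemma coeff_vec_recurrence:
  assumes v: "v \<in> carrier_vec n"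
  shows "(C + of_nat i \<cdot>\<^sub>m 1\<^sub>m n) *\<^sub>v coeff_vec v (Suc i) = hyp_step n U W i *\<^sub>v coeff_vec v i"
proof -
  obtain B where B: "mat_inverse (C + of_nat i \<cdot>\<^sub>m 1\<^sub>m n) = Some B" "B \<in> carrier_mat n n"
    "(C + of_nat i \<cdot>\<^sub>m 1\<^sub>m n) * B = 1\<^sub>m n" by (rule C_shift_mat_inverse)
  let ?S = "C + of_nat i \<cdot>\<^sub>m 1\<^sub>m n" and ?M = "hyp_step n U W i" and ?H = "hyp_coeff n C U W i"
  have "hyp_coeff n C U W (Suc i) = B * ?M * ?H"
    using B by (simp add: hyp_step_def)
  moreover have Mx: "?M *\<^sub>v coeff_vec v i \<in> carrier_vec n"
    by (rule mult_mat_vec_carrier[OF hyp_step_carrier coeff_vec_carrier[OF v]])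
  ultimately have "coeff_vec v (Suc i) = B *\<^sub>v (?M *\<^sub>v coeff_vec v i)"
    using B(2) v assoc_mult_mat_vec[OF mult_carrier_mat[OF B(2) hyp_step_carrier] hyp_coeff_carrier v]
      assoc_mult_mat_vec[OF B(2) hyp_step_carrier coeff_vec_carrier[OF v]] by metis
  hence "?S *\<^sub>v coeff_vec v (Suc i) = (?S * B) *\<^sub>v (?M *\<^sub>v coeff_vec v i)"
    using assoc_mult_mat_vec[OF C_shift_carrier B(2) Mx] by metis
  also have "\<dots> = ?M *\<^sub>v coeff_vec v i"
    unfolding B(3) by (rule one_mult_mat_vec[OF Mx])
  finally show ?thesis .
qed

lemma coeff_vec_Suc_eq_zero_iff:
  assumes v: "v \<in> carrier_vec n"
  shows "coeff_vec v (Suc i) = 0\<^sub>v n \<longleftrightarrow> hyp_step n U W i *\<^sub>v coeff_vec v i = 0\<^sub>v n"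
proof
  assume "coeff_vec v (Suc i) = 0\<^sub>v n"
  thus "hyp_step n U W i *\<^sub>v coeff_vec v i = 0\<^sub>v n"
    using coeff_vec_recurrence[OF v, of i] mult_mat_zero_vec[OF C_shift_carrier, of i] by metis
next
  assume "hyp_step n U W i *\<^sub>v coeff_vec v i = 0\<^sub>v n"
  thus "coeff_vec v (Suc i) = 0\<^sub>v n"
    using coeff_vec_recurrence[OF v, of i] coeff_vec_carrier[OF v, of "Suc i"]
      det_nonzero_imp_mult_vec_eq_zero[OF C_shift_carrier det_C_shift] by metis
qed

lemma coeff_vec_Suc_eq_zero_iff_det:
  assumes v: "v \<in> carrier_vec n" and det: "det (hyp_step n U W i) \<noteq> 0"
  shows "coeff_vec v (Suc i) = 0\<^sub>v n \<longleftrightarrow> coeff_vec v i = 0\<^sub>v n"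
  unfolding coeff_vec_Suc_eq_zero_iff[OF v]
  using det_nonzero_imp_mult_vec_eq_zero[OF hyp_step_carrier det coeff_vec_carrier[OF v]]
    mult_mat_zero_vec[OF hyp_step_carrier] by metis

subsection \<open>Convergence on the unit disc\<close>

text \<open>The bound is obtained without estimating the inverse of \<open>C + i\<close>: in
  \<open>i x\<^bsub>i+1\<^esub> = M\<^sub>i x\<^sub>i - C x\<^bsub>i+1\<^esub>\<close> the last term is absorbed into the left-hand side. The constants
  \<open>c\<close>, \<open>b\<close>, \<open>d\<close> are operator bounds for \<open>C\<close>, \<open>U\<close> and \<open>W\<close>.\<close>

lemma vec_l1_coeff_vec_Suc:
  "\<exists>c b d. \<forall>v\<in>carrier_vec n. \<forall>i.
    (real i - c) * vec_l1 (coeff_vec v (Suc i)) \<le>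
    (real i * (b + real i + 1) + d) * vec_l1 (coeff_vec v i)"
proof -
  obtain c where c: "\<And>v. v \<in> carrier_vec n \<Longrightarrow> vec_l1 (C *\<^sub>v v) \<le> c * vec_l1 v"
    using mult_mat_vec_bounded[OF C_carrier] by blast
  obtain b where b: "\<And>v. v \<in> carrier_vec n \<Longrightarrow> vec_l1 (U *\<^sub>v v) \<le> b * vec_l1 v"
    using mult_mat_vec_bounded[OF U_carrier] by blast
  obtain d where d: "\<And>v. v \<in> carrier_vec n \<Longrightarrow> vec_l1 (W *\<^sub>v v) \<le> d * vec_l1 v"
    using mult_mat_vec_bounded[OF W_carrier] by blast
  show ?thesis
  proof (intro exI ballI allI)
    fix v :: "complex vec" and i assume v: "v \<in> carrier_vec n"
    define x y where "x = coeff_vec v i" and "y = coeff_vec v (Suc i)"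
    have x: "x \<in> carrier_vec n" and y: "y \<in> carrier_vec n"
      unfolding x_def y_def by (rule coeff_vec_carrier[OF v])+
    have "of_nat i \<cdot>\<^sub>v y = hyp_step n U W i *\<^sub>v x + (- 1) \<cdot>\<^sub>v (C *\<^sub>v y)"
    proof -
      have "(C + of_nat i \<cdot>\<^sub>m 1\<^sub>m n) *\<^sub>v y = C *\<^sub>v y + of_nat i \<cdot>\<^sub>v y"
        using C_carrier y by (subst add_mult_distrib_mat_vec[of _ n n]) 
          (auto simp: smult_mat_mult_vec[of _ n n])
      with coeff_vec_recurrence[OF v, of i]
      have "hyp_step n U W i *\<^sub>v x = C *\<^sub>v y + of_nat i \<cdot>\<^sub>v y"
        unfolding x_def y_def by simp
      thus ?thesis using C_carrier y by (intro eq_vecI) auto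
    qed
    hence "real i * vec_l1 y \<le> vec_l1 (hyp_step n U W i *\<^sub>v x) + vec_l1 (C *\<^sub>v y)"
      using vec_l1_add[of "hyp_step n U W i *\<^sub>v x" n "(- 1) \<cdot>\<^sub>v (C *\<^sub>v y)"] C_carrier x y
        vec_l1_smult[of "of_nat i" y]
        mult_mat_vec_carrier[OF hyp_step_carrier x]
      by (metis mult_1 mult_mat_vec_carrier norm_minus_cancel norm_of_nat norm_one smult_carrier_vec vec_l1_smult)
    moreover have "vec_l1 (hyp_step n U W i *\<^sub>v x)
        \<le> (real i * (b + real i + 1) + d) * vec_l1 x"
    proof -
      have "hyp_step n U W i *\<^sub>v x
          = of_nat i \<cdot>\<^sub>v (U *\<^sub>v x + (of_nat i - 1) \<cdot>\<^sub>v x) + W *\<^sub>v x"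
        unfolding hyp_step_def using U_carrier W_carrier x
        by (simp add: add_mult_distrib_mat_vec[of _ n n] smult_mat_mult_vec[of _ n n])
      also have "vec_l1 \<dots> \<le> real i * vec_l1 (U *\<^sub>v x + (of_nat i - 1) \<cdot>\<^sub>v x) + vec_l1 (W *\<^sub>v x)"
        using vec_l1_add[of "of_nat i \<cdot>\<^sub>v (U *\<^sub>v x + (of_nat i - 1) \<cdot>\<^sub>v x)" n "W *\<^sub>v x"]
          U_carrier W_carrier x by simp
      also have "\<dots> \<le> real i * (vec_l1 (U *\<^sub>v x) + norm (of_nat i - 1 :: complex) * vec_l1 x)
          + vec_l1 (W *\<^sub>v x)"
        using vec_l1_add[of "U *\<^sub>v x" n "(of_nat i - 1) \<cdot>\<^sub>v x"] U_carrier x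
        by (intro add_mono mult_left_mono) auto
      also have "\<dots> \<le> real i * (b * vec_l1 x + (real i + 1) * vec_l1 x) + d * vec_l1 x"
        using b[OF x] d[OF x] norm_triangle_ineq4[of "of_nat i :: complex" 1]
        by (intro add_mono mult_left_mono mult_right_mono) auto
      finally show ?thesis by (simp add: algebra_simps)
    qed
    ultimately have "(real i - c) * vec_l1 y \<le> (real i * (b + real i + 1) + d) * vec_l1 x"
      using c[OF y] by (simp add: algebra_simps)
    thus "(real i - c) * vec_l1 (coeff_vec v (Suc i)) \<le>
      (real i * (b + real i + 1) + d) * vec_l1 (coeff_vec v i)"
      unfolding x_def y_def .
  qed
qed

text \<open>A ratio test on the 1-norms of the terms: by the growth bound, consecutive ones have a ratio
  of at most \<open>ratio i * norm u\<close>, and \<open>ratio\<close> tends to \<open>1\<close>.\<close>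

lemma summable_coeff_vec:
  assumes v: "v \<in> carrier_vec n" and r: "r < n" and u: "norm u < 1"
  shows "summable (\<lambda>i. u ^ i / fact i * coeff_vec v i $ r)"
proof -
  obtain c b d where growth: "\<And>i. (real i - c) * vec_l1 (coeff_vec v (Suc i)) \<le>
      (real i * (b + real i + 1) + d) * vec_l1 (coeff_vec v i)"
    using vec_l1_coeff_vec_Suc v by blast
  (* ratio i * norm u tends to norm u, so it eventually stays below any such q *)
  obtain q where q: "norm u < q" "q < 1"
    using dense[OF u] by blast
  define ratio where "ratio i = (real i * (b + real i + 1) + d) / ((real i - c) * (real i + 1))" for i
  have "ratio \<longlonglongrightarrow> 1"
    unfolding ratio_def by real_asymp
  hence "(\<lambda>i. ratio i * norm u) \<longlonglongrightarrow> 1 * norm u"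
    by (intro tendsto_intros)
  hence "eventually (\<lambda>i. ratio i * norm u < q) sequentially"
    using q by (intro order_tendstoD) auto
  moreover have "eventually (\<lambda>i. real i > c) sequentially"
    by real_asymp
  ultimately have "eventually (\<lambda>i. ratio i * norm u < q \<and> real i > c) sequentially"
    by eventually_elim auto
  then obtain N where N: "\<And>i. i \<ge> N \<Longrightarrow> ratio i * norm u < q \<and> real i > c"
    unfolding eventually_sequentially by blast
  define f where "f i = vec_l1 (coeff_vec v i) * norm u ^ i / fact i" for i
  have f_nonneg: "f i \<ge> 0" for i by (simp add: f_def)
  have "summable f"
  proof (rule summable_ratio_test[OF q(2)])
    fix i assume i: "N \<le> i"
    have pos: "real i - c > 0" using N[OF i] by simp
    have "vec_l1 (coeff_vec v (Suc i)) / (real i + 1) \<le> ratio i * vec_l1 (coeff_vec v i)"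
    proof -
      have "vec_l1 (coeff_vec v (Suc i)) \<le>
          (real i * (b + real i + 1) + d) * vec_l1 (coeff_vec v i) / (real i - c)"
        using growth[of i] by (subst pos_le_divide_eq[OF pos]) (simp only: mult.commute)
      from divide_right_mono[OF this, of "real i + 1"] show ?thesis
        by (simp add: ratio_def del: hyp_coeff.simps)
    qed
    hence "vec_l1 (coeff_vec v (Suc i)) / (real i + 1) * (norm u ^ Suc i / fact i)
        \<le> ratio i * vec_l1 (coeff_vec v i) * (norm u ^ Suc i / fact i)"
      by (rule mult_right_mono) simp
    also have "\<dots> = ratio i * norm u * f i"
      by (simp add: f_def)
    also have "\<dots> \<le> q * f i"
      using N[OF i] f_nonneg by (intro mult_right_mono) auto
    finally show "norm (f (Suc i)) \<le> q * norm (f i)"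
      using f_nonneg by (simp add: f_def add.commute del: hyp_coeff.simps)
  qed
  thus ?thesis
  proof (rule summable_comparison_test[rotated], intro exI allI impI)
    fix i
    have "norm (coeff_vec v i $ r) \<le> vec_l1 (coeff_vec v i)"
      using norm_component_le_vec_l1[of r "coeff_vec v i"] coeff_vec_carrier[OF v, of i] r
      by (metis carrier_vecD)
    from mult_left_mono[OF this, of "norm u ^ i / fact i"]
    show "norm (u ^ i / fact i * coeff_vec v i $ r) \<le> f i"
      by (simp add: f_def norm_mult norm_divide norm_power mult.commute del: index_mult_mat_vec)
  qed
qed

text \<open>The series in \<^const>\<open>matrix_2H1\<close> is summed entry by entry, so the columns of the coefficients
  are needed separately; column \<open>s\<close> is the case of the unit vector with index \<open>s\<close>.\<close>

lemma summable_hyp_coeff: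
  assumes "r < n" "s < n" "norm u < 1"
  shows "summable (\<lambda>i. u ^ i / fact i * hyp_coeff n C U W i $$ (r, s))"
proof -
  have "coeff_vec (unit_vec n s) i $ r = hyp_coeff n C U W i $$ (r, s)" for i
    using assms hyp_coeff_carrier[of i] by (simp add: scalar_prod_right_unit)
  with summable_coeff_vec[of "unit_vec n s" r u] assms show ?thesis by simp
qed

lemma matrix_2H1_mult_vec_sums:
  assumes v: "v \<in> carrier_vec n" and r: "r < n" and u: "norm u < 1"
  shows "(\<lambda>i. coeff_vec v i $ r / fact i * u ^ i) sums (matrix_2H1 n U W C u *\<^sub>v v) $ r"
proof -
  have "(\<lambda>i. \<Sum>s\<in>{0..<n}. u ^ i / fact i * hyp_coeff n C U W i $$ (r, s) * v $ s) sums
      (\<Sum>s\<in>{0..<n}. (\<Sum>i. u ^ i / fact i * hyp_coeff n C U W i $$ (r, s)) * v $ s)"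
    using r u by (intro sums_sum sums_mult2 summable_sums summable_hyp_coeff) auto
  also have "(\<Sum>s\<in>{0..<n}. (\<Sum>i. u ^ i / fact i * hyp_coeff n C U W i $$ (r, s)) * v $ s)
      = (matrix_2H1 n U W C u *\<^sub>v v) $ r"
    using v r by (simp add: matrix_2H1_def scalar_prod_def)
  also have "(\<lambda>i. \<Sum>s\<in>{0..<n}. u ^ i / fact i * hyp_coeff n C U W i $$ (r, s) * v $ s)
      = (\<lambda>i. coeff_vec v i $ r / fact i * u ^ i)"
  proof
    fix i
    have "coeff_vec v i $ r = (\<Sum>s\<in>{0..<n}. hyp_coeff n C U W i $$ (r, s) * v $ s)"
      using v r hyp_coeff_carrier[of i] by (simp add: scalar_prod_def)
    thus "(\<Sum>s\<in>{0..<n}. u ^ i / fact i * hyp_coeff n C U W i $$ (r, s) * v $ s)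
      = coeff_vec v i $ r / fact i * u ^ i"
      by (simp add: sum_distrib_left sum_divide_distrib sum_distrib_right mult_ac)
  qed
  finally show ?thesis .
qed

subsection \<open>Polynomial solutions\<close>

text \<open>A polynomial vector is determined by its values on the disc, coefficient by coefficient, so it
  represents the function precisely if its coefficients are those of the series.\<close>

lemma represents_on_disc_matrix_2H1_iff:
  assumes v: "v \<in> carrier_vec n" and P: "P \<in> carrier_vec n"
  shows "represents_on_disc n (\<lambda>u. matrix_2H1 n U W C u *\<^sub>v v) P \<longleftrightarrow>
    (\<forall>r<n. \<forall>i. coeff (P $ r) i = coeff_vec v i $ r / fact i)" (is "?L \<longleftrightarrow> ?R")
proof
  assume L: ?L
  show ?R
  proof (intro allI impI)
    fix r i assume r: "r < n"
    have "(\<lambda>i. coeff_vec v i $ r / fact i * u ^ i) sums poly (P $ r) u" if u: "norm u < 1" for u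
    proof -
      have "matrix_2H1 n U W C u *\<^sub>v v = map_vec (\<lambda>p. poly p u) P"
        using L u by (simp add: represents_on_disc_def)
      with matrix_2H1_mult_vec_sums[OF v r u] r P show ?thesis by (simp del: index_mult_mat_vec)
    qed
    from poly_eq_powser_imp_coeff_eq[OF this] show "coeff (P $ r) i = coeff_vec v i $ r / fact i"
      by simp
  qed
next
  assume R: ?R
  show ?L
    unfolding represents_on_disc_def
  proof (intro conjI allI impI P eq_vecI)
    fix u :: complex and r
    assume u: "norm u < 1" and "r < dim_vec (map_vec (\<lambda>p. poly p u) P)"
    hence r: "r < n" using P by simp
    have "(\<lambda>i. coeff (P $ r) i * u ^ i) sums (\<Sum>i\<le>degree (P $ r). coeff (P $ r) i * u ^ i)"
      by (rule sums_finite) (auto simp: coeff_eq_0)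
    hence "(\<lambda>i. coeff_vec v i $ r / fact i * u ^ i) sums poly (P $ r) u"
      using R r by (simp add: poly_altdef)
    with matrix_2H1_mult_vec_sums[OF v r u]
    have "(matrix_2H1 n U W C u *\<^sub>v v) $ r = poly (P $ r) u"
      by (rule sums_unique2)
    thus "(matrix_2H1 n U W C u *\<^sub>v v) $ r = map_vec (\<lambda>p. poly p u) P $ r"
      using r P by simp
  qed (use P in \<open>auto simp: matrix_2H1_def\<close>)
qed

lemma vec_polynomial_matrix_2H1_iff:
  assumes v: "v \<in> carrier_vec n"
  shows "vec_polynomial n (\<lambda>u. matrix_2H1 n U W C u *\<^sub>v v) \<longleftrightarrow>
    (\<exists>d. \<forall>i>d. coeff_vec v i = 0\<^sub>v n)" (is "?L \<longleftrightarrow> ?R")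
proof
  assume ?L
  then obtain P where rep: "represents_on_disc n (\<lambda>u. matrix_2H1 n U W C u *\<^sub>v v) P"
    unfolding vec_polynomial_def by blast
  hence P: "P \<in> carrier_vec n" by (simp add: represents_on_disc_def)
  define d where "d = (\<Sum>r<n. degree (P $ r))"
  have "coeff_vec v i = 0\<^sub>v n" if i: "i > d" for i
  proof (rule eq_vecI)
    fix r assume "r < dim_vec (0\<^sub>v n :: complex vec)"
    hence r: "r < n" by simp
    have "degree (P $ r) \<le> d"
      unfolding d_def using r by (intro member_le_sum) auto
    hence "coeff (P $ r) i = 0" using i by (intro coeff_eq_0) simp
    hence "coeff_vec v i $ r = 0"
      using rep[unfolded represents_on_disc_matrix_2H1_iff[OF v P]] r by simp
    thus "coeff_vec v i $ r = 0\<^sub>v n $ r" using r by simp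
  qed (use hyp_coeff_carrier[of i] in simp)
  thus ?R by blast
next
  assume ?R
  then obtain d where d: "\<And>i. i > d \<Longrightarrow> coeff_vec v i = 0\<^sub>v n" by blast
  define P where "P = vec n (\<lambda>r. \<Sum>i\<le>d. monom (coeff_vec v i $ r / fact i) i)"
  have P: "P \<in> carrier_vec n" by (simp add: P_def)
  have "represents_on_disc n (\<lambda>u. matrix_2H1 n U W C u *\<^sub>v v) P"
    unfolding represents_on_disc_matrix_2H1_iff[OF v P]
  proof (intro allI impI)
    fix r i assume r: "r < n"
    show "coeff (P $ r) i = coeff_vec v i $ r / fact i"
    proof (cases "i \<le> d")
      case True
      thus ?thesis using r by (simp add: P_def coeff_sum del: index_mult_mat_vec)
    next
      case False
      thus ?thesis using r d[of i] by (simp add: P_def coeff_sum del: index_mult_mat_vec)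
    qed
  qed
  thus ?L unfolding vec_polynomial_def by blast
qed

lemma vec_polynomial_of_degree_matrix_2H1:
  assumes v: "v \<in> carrier_vec n"
    and top: "coeff_vec v d \<noteq> 0\<^sub>v n" and above: "\<And>i. i > d \<Longrightarrow> coeff_vec v i = 0\<^sub>v n"
  shows "vec_polynomial_of_degree n (\<lambda>u. matrix_2H1 n U W C u *\<^sub>v v) d"
proof -
  have "vec_polynomial n (\<lambda>u. matrix_2H1 n U W C u *\<^sub>v v)"
    unfolding vec_polynomial_matrix_2H1_iff[OF v] using above by blast
  then obtain P where rep: "represents_on_disc n (\<lambda>u. matrix_2H1 n U W C u *\<^sub>v v) P"
    unfolding vec_polynomial_def by blast
  hence P: "P \<in> carrier_vec n" by (simp add: represents_on_disc_def)
  note coeffs = rep[unfolded represents_on_disc_matrix_2H1_iff[OF v P], rule_format]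
  obtain r where r: "r < n" "coeff_vec v d $ r \<noteq> 0"
    using top coeff_vec_carrier[OF v, of d] by (metis carrier_vecD eq_vecI index_zero_vec)
  have "coeff (P $ r) d \<noteq> 0" using coeffs[OF r(1), of d] r(2) by simp
  hence "P $ r \<noteq> 0" and deg_ge: "d \<le> degree (P $ r)"
    by (auto intro: le_degree)
  have deg_le: "degree (P $ s) \<le> d" if "s < n" for s
    using coeffs[OF that] above that by (intro degree_le) (simp del: index_mult_mat_vec)
  have "(MAX s\<in>{..<n}. degree (P $ s)) = d"
    using r(1) deg_ge deg_le by (intro Max_eqI) (auto simp: image_iff intro!: bexI[of _ r] antisym)
  moreover have "P \<noteq> 0\<^sub>v n"
    using \<open>P $ r \<noteq> 0\<close> r(1) by auto
  ultimately show ?thesis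
    using rep unfolding vec_polynomial_of_degree_def by blast
qed

text \<open>The case of interest: only at the index \<open>w\<close> can a step of the recursion annihilate a nonzero
  coefficient.\<close>

context
  fixes w :: nat
  assumes det_step: "\<And>i. i \<noteq> w \<Longrightarrow> det (hyp_step n U W i) \<noteq> 0"
begin

lemma coeff_vec_eq_zero_iff_up_to:
  assumes v: "v \<in> carrier_vec n" and "i \<le> w"
  shows "coeff_vec v i = 0\<^sub>v n \<longleftrightarrow> v = 0\<^sub>v n"
  using \<open>i \<le> w\<close>
proof (induction i)
  case (Suc i)
  thus ?case using coeff_vec_Suc_eq_zero_iff_det[OF v det_step, of i] by simp
qed (use v in simp)

lemma coeff_vec_eq_zero_iff_above:
  assumes v: "v \<in> carrier_vec n" and "w < i"
  shows "coeff_vec v i = 0\<^sub>v n \<longleftrightarrow> coeff_vec v (Suc w) = 0\<^sub>v n"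
proof -
  from \<open>w < i\<close> have "Suc w \<le> i" by simp
  thus ?thesis
  proof (induction i rule: dec_induct)
    case (step i)
    thus ?case using coeff_vec_Suc_eq_zero_iff_det[OF v det_step, of i] by simp
  qed simp
qed

lemma vec_polynomial_iff_kernel:
  assumes v: "v \<in> carrier_vec n"
  shows "vec_polynomial n (\<lambda>u. matrix_2H1 n U W C u *\<^sub>v v) \<longleftrightarrow>
    hyp_step n U W w *\<^sub>v coeff_vec v w = 0\<^sub>v n"
proof -
  have "(\<exists>d. \<forall>i>d. coeff_vec v i = 0\<^sub>v n) \<longleftrightarrow> coeff_vec v (Suc w) = 0\<^sub>v n"
  proof
    assume "\<exists>d. \<forall>i>d. coeff_vec v i = 0\<^sub>v n"
    then obtain d where "\<forall>i>d. coeff_vec v i = 0\<^sub>v n" by blast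
    hence "coeff_vec v (Suc (max d w)) = 0\<^sub>v n"
      by (metis less_Suc_eq_le max.cobounded1)
    moreover have "w < Suc (max d w)" by simp
    ultimately show "coeff_vec v (Suc w) = 0\<^sub>v n"
      using coeff_vec_eq_zero_iff_above[OF v] by blast
  next
    assume "coeff_vec v (Suc w) = 0\<^sub>v n"
    thus "\<exists>d. \<forall>i>d. coeff_vec v i = 0\<^sub>v n"
      using coeff_vec_eq_zero_iff_above[OF v] by blast
  qed
  thus ?thesis
    unfolding vec_polynomial_matrix_2H1_iff[OF v] coeff_vec_Suc_eq_zero_iff[OF v] .
qed

lemma vec_polynomial_imp_degree:
  assumes v: "v \<in> carrier_vec n" "v \<noteq> 0\<^sub>v n"
    and poly: "vec_polynomial n (\<lambda>u. matrix_2H1 n U W C u *\<^sub>v v)"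
  shows "vec_polynomial_of_degree n (\<lambda>u. matrix_2H1 n U W C u *\<^sub>v v) w"
proof (rule vec_polynomial_of_degree_matrix_2H1[OF v(1)])
  show "coeff_vec v w \<noteq> 0\<^sub>v n"
    using coeff_vec_eq_zero_iff_up_to[OF v(1), of w] v(2) by simp
  show "coeff_vec v i = 0\<^sub>v n" if "w < i" for i
    using poly coeff_vec_eq_zero_iff_above[OF v(1) that]
    unfolding vec_polynomial_iff_kernel[OF v(1)] coeff_vec_Suc_eq_zero_iff[OF v(1), symmetric] by simp
qed

lemma det_hyp_coeff_nonzero: "det (hyp_coeff n C U W w) \<noteq> 0"
  using coeff_vec_eq_zero_iff_up_to[of _ w] det_0_iff_vec_prod_zero_field[OF hyp_coeff_carrier, of w]
  by auto

lemma coeff_vec_surj: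
  assumes x: "x \<in> carrier_vec n"
  obtains v where "v \<in> carrier_vec n" "coeff_vec v w = x"
proof -
  let ?H = "hyp_coeff n C U W w"
  from det_non_zero_imp_unit[OF hyp_coeff_carrier det_hyp_coeff_nonzero] 
  obtain B where B: "B \<in> carrier_mat n n" "?H * B = 1\<^sub>m n"
    by (auto simp: Units_def ring_mat_def)
  show thesis
  proof (rule that[of "B *\<^sub>v x"])
    show "B *\<^sub>v x \<in> carrier_vec n" using B x by auto
    show "coeff_vec (B *\<^sub>v x) w = x"
      using B x hyp_coeff_carrier[of w] by (metis assoc_mult_mat_vec one_mult_mat_vec)
  qed
qed

text \<open>The map from \<open>v\<close> to the coefficient at \<open>w\<close> is a linear bijection that takes the vectors with
  polynomial solution onto the kernel of the step matrix at \<open>w\<close>. That kernel is a line, hence so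
  is its preimage.\<close>

lemma polynomial_solution_unique:
  assumes upper: "upper_triangular (hyp_step n U W w)"
    and diag: "\<And>r. r < n \<Longrightarrow> hyp_step n U W w $$ (r, r) = 0 \<longleftrightarrow> r = j" and j: "j < n"
  shows "\<exists>v\<in>carrier_vec n. v \<noteq> 0\<^sub>v n
    \<and> vec_polynomial n (\<lambda>u. matrix_2H1 n U W C u *\<^sub>v v)
    \<and> (\<forall>x\<in>carrier_vec n. x \<noteq> 0\<^sub>v n \<and> vec_polynomial n (\<lambda>u. matrix_2H1 n U W C u *\<^sub>v x)
          \<longrightarrow> (\<exists>c. x = c \<cdot>\<^sub>v v))
    \<and> vec_polynomial_of_degree n (\<lambda>u. matrix_2H1 n U W C u *\<^sub>v v) w"
proof -
  let ?M = "hyp_step n U W w"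
  have "0 \<in> set (diag_mat ?M)"
    using diag[OF j] j carrier_matD(1)[OF hyp_step_carrier]
    by (auto simp: diag_mat_def image_iff intro!: bexI[of _ j])
  hence "det ?M = 0"
    using det_upper_triangular[OF upper hyp_step_carrier] prod_list_zero_iff by metis
  then obtain y where y: "y \<in> carrier_vec n" "y \<noteq> 0\<^sub>v n" "?M *\<^sub>v y = 0\<^sub>v n"
    using det_0_iff_vec_prod_zero_field[OF hyp_step_carrier] by blast
  obtain v where v: "v \<in> carrier_vec n" "coeff_vec v w = y"
    using coeff_vec_surj[OF y(1)] .
  have "v \<noteq> 0\<^sub>v n"
    using v y coeff_vec_eq_zero_iff_up_to[OF v(1), of w] by auto
  moreover have poly: "vec_polynomial n (\<lambda>u. matrix_2H1 n U W C u *\<^sub>v v)"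
    using v y by (simp add: vec_polynomial_iff_kernel)
  moreover have "\<exists>c. x = c \<cdot>\<^sub>v v"
    if x: "x \<in> carrier_vec n" and "vec_polynomial n (\<lambda>u. matrix_2H1 n U W C u *\<^sub>v x)" for x
  proof -
    have "?M *\<^sub>v coeff_vec x w = 0\<^sub>v n"
      using that vec_polynomial_iff_kernel by blast
    then obtain c where c: "coeff_vec x w = c \<cdot>\<^sub>v y"
      using upper_triangular_kernel_1_dim[OF hyp_step_carrier upper _ j y(1,3,2)
          coeff_vec_carrier[OF x]] diag by blast
    have "coeff_vec (x - c \<cdot>\<^sub>v v) w = coeff_vec x w - c \<cdot>\<^sub>v y"
      using v x mult_minus_distrib_mat_vec[OF hyp_coeff_carrier x, of "c \<cdot>\<^sub>v v" w]
        mult_mat_vec[OF hyp_coeff_carrier v(1), of w c] by simp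
    hence "coeff_vec (x - c \<cdot>\<^sub>v v) w = 0\<^sub>v n"
      using c y(1) by simp
    hence zero: "x - c \<cdot>\<^sub>v v = 0\<^sub>v n"
      using coeff_vec_eq_zero_iff_up_to[of "x - c \<cdot>\<^sub>v v" w] x v by simp
    have "x = c \<cdot>\<^sub>v v"
      using zero x v(1) by (auto intro: vec_diff_eq_zero_imp_eq[of _ n])
    thus ?thesis ..
  qed
  moreover have "vec_polynomial_of_degree n (\<lambda>u. matrix_2H1 n U W C u *\<^sub>v v) w"
    by (rule vec_polynomial_imp_degree) fact+
  ultimately show ?thesis using v(1) by blast
qed

end

end

section \<open>The matrices of Jacobi type\<close>

lemma det_C_mat_shift:
  assumes "\<beta> > -1"
  shows "det (C_mat \<beta> l + of_nat i \<cdot>\<^sub>m 1\<^sub>m (l + 1)) \<noteq> 0"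
proof -
  let ?A = "C_mat \<beta> l + of_nat i \<cdot>\<^sub>m 1\<^sub>m (l + 1)"
  have A: "?A \<in> carrier_mat (l + 1) (l + 1)" by (simp add: C_mat_def)
  have diag: "?A $$ (r, r) \<noteq> 0" if "r < l + 1" for r
  proof -
    have "?A $$ (r, r) = of_real (\<beta> + 1 + 2 * real r + real i)"
      using that by (simp add: C_mat_def)
    moreover have "\<beta> + 1 + 2 * real r + real i > 0" using assms by simp
    ultimately show ?thesis by (metis of_real_eq_0_iff less_irrefl)
  qed
  have "det ?A = prod_list (diag_mat ?A)"
    by (rule det_lower_triangular[OF _ A]) (auto simp: C_mat_def)
  thus ?thesis using diag A by (auto simp: prod_list_zero_iff diag_mat_def)
qed

text \<open>This explains the formula for the eigenvalues: \<open>\<lambda>\<^sub>r(i)\<close> is the value of \<open>\<lambda>\<close> for which the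
  diagonal entry in row \<open>r\<close> of the \<open>i\<close>-th step matrix vanishes.\<close>

lemma hyp_step_jacobi:
  defines "M \<equiv> \<lambda>\<alpha> \<beta> k l lam i.
    hyp_step (l + 1) (U_mat \<alpha> \<beta> l) (V_mat \<alpha> \<beta> k l + complex_of_real lam \<cdot>\<^sub>m 1\<^sub>m (l + 1)) i"
  shows "upper_triangular (M \<alpha> \<beta> k l lam i)"
    and "r \<le> l \<Longrightarrow> M \<alpha> \<beta> k l lam i $$ (r, r) = of_real (lam - jacobi_eigenvalue \<alpha> \<beta> k l r i)"
proof -
  show "upper_triangular (M \<alpha> \<beta> k l lam i)"
    by (rule upper_triangularI) (auto simp: M_def hyp_step_def U_mat_def V_mat_def)
  show "M \<alpha> \<beta> k l lam i $$ (r, r) = of_real (lam - jacobi_eigenvalue \<alpha> \<beta> k l r i)" if "r \<le> l"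
    using that by (simp add: M_def hyp_step_def U_mat_def V_mat_def jacobi_eigenvalue_def algebra_simps)
qed

theorem proposition2p1:
  fixes \<alpha> \<beta> k lam :: real and l w j :: nat
  assumes "\<alpha> > -1" and "\<beta> > -1" and "0 < k" and "k < \<beta> + 1" and "l \<ge> 1"
    and "inj_on (\<lambda>(w', j'). jacobi_eigenvalue \<alpha> \<beta> k l j' w') (UNIV \<times> {..l})"
    and "j \<le> l" and "lam = jacobi_eigenvalue \<alpha> \<beta> k l j w"
  shows "\<exists>F0 \<in> carrier_vec (l + 1).
           F0 \<noteq> 0\<^sub>v (l + 1)
         \<and> vec_polynomial (l + 1) (F_fun \<alpha> \<beta> k l (of_real lam) F0)
         \<and> (\<forall>G0 \<in> carrier_vec (l + 1).
              G0 \<noteq> 0\<^sub>v (l + 1) \<and> vec_polynomial (l + 1) (F_fun \<alpha> \<beta> k l (of_real lam) G0)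
              \<longrightarrow> (\<exists>c. G0 = c \<cdot>\<^sub>v F0))
         \<and> vec_polynomial_of_degree (l + 1) (F_fun \<alpha> \<beta> k l (of_real lam) F0) w"
proof -
  let ?W = "V_mat \<alpha> \<beta> k l + complex_of_real lam \<cdot>\<^sub>m 1\<^sub>m (l + 1)"
  let ?M = "hyp_step (l + 1) (U_mat \<alpha> \<beta> l) ?W"
  interpret matrix_hypergeometric "l + 1" "C_mat \<beta> l" "U_mat \<alpha> \<beta> l" ?W
    using det_C_mat_shift[OF assms(2)]
    by unfold_locales (auto simp: C_mat_def U_mat_def V_mat_def)
  have diag: "?M i $$ (r, r) = 0 \<longleftrightarrow> i = w \<and> r = j" if "r < l + 1" for i r
  proof -
    have "?M i $$ (r, r) = 0 \<longleftrightarrow>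
        jacobi_eigenvalue \<alpha> \<beta> k l r i = jacobi_eigenvalue \<alpha> \<beta> k l j w"
      using hyp_step_jacobi(2)[of r l \<alpha> \<beta> k lam i] that assms(8) by auto
    also have "\<dots> \<longleftrightarrow> i = w \<and> r = j"
      using inj_on_eq_iff[OF assms(6), of "(i, r)" "(w, j)"] that assms(7) by auto
    finally show ?thesis .
  qed
  have det: "det (?M i) \<noteq> 0" if "i \<noteq> w" for i
  proof -
    have "det (?M i) = prod_list (diag_mat (?M i))"
      by (rule det_upper_triangular[OF hyp_step_jacobi(1) hyp_step_carrier])
    thus ?thesis
      using diag that hyp_step_carrier[of i] by (auto simp: prod_list_zero_iff diag_mat_def)
  qed
  have F_fun_eq: "F_fun \<alpha> \<beta> k l (of_real lam) v =
      (\<lambda>u. matrix_2H1 (l + 1) (U_mat \<alpha> \<beta> l) ?W (C_mat \<beta> l) u *\<^sub>v v)" for v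
    by (rule ext) (simp add: F_fun_def)
  show ?thesis
    unfolding F_fun_eq
  proof (rule polynomial_solution_unique[where w = w and j = j])
    show "upper_triangular (?M w)" by (rule hyp_step_jacobi(1))
  qed (use det diag assms(7) in auto)
qed

end
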